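(* There exist a constant $c>0$ and an integer $n_0$ such that for every integer $n\ge n_0$, \[ \sup_{d\ge 2}\ \sup_{\rho\in \mathrm{BEXT}_{n,n}(d,d)}\ \inf_{\sigma\in \mathrm{SEP}(d,d)}\ \|\rho-\sigma\|_2\ \ge\ c\,n^{-1/2}. \]
   Context: $\mathrm D(\mathcal H)$ denotes the density operators on a finite-dimensional complex Hilbert space $\mathcal H$, and $\|X\|_2=\sqrt{\mathrm{Tr}(X^\dagger X)}$ is the Hilbert--Schmidt norm. $\mathrm{Sym}^n(\mathcal H)\subseteq\mathcal H^{\otimes n}$ is the symmetric subspace. $\mathrm{SEP}(d,d):=\mathrm{conv}\{|u\rangle\langle u|\otimes|v\rangle\langle v|:u,v\in\mathbb C^{d},\ \|u\|=\|v\|=1\}$. Label the tensor factors of $(\mathbb C^{d})^{\otimes n}\otimes(\mathbb C^{d})^{\otimes n}$ as $A_1,\dots,A_n,B_1,\dots,B_n$. $\mathrm{BEXT}_{n,n}(d,d)$ is the set of $A_1B_1$-marginals of states $\widetilde\rho\in\mathrm D(\mathrm{Sym}^n(\mathbb C^{d})\otimes\mathrm{Sym}^n(\mathbb C^{d}))$. *)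

theory Defs
  imports "HOL-Analysis.Analysis" "HOL-Library.Function_Algebras"
    "HOL-Combinatorics.Permutations"
begin

text \<open>
  Dimensions vary inside the statements of interest, so Hilbert spaces are not indexed by types.
  For a finite set \<open>I\<close> of labels, \<open>\<complex>\<^sup>I\<close> is represented by the functions \<open>'i \<Rightarrow> complex\<close> vanishing
  outside \<open>I\<close>, and operators on it by their matrix in the standard basis, a function
  \<open>'i \<Rightarrow> 'i \<Rightarrow> complex\<close> (row, column) vanishing outside \<open>I \<times> I\<close>.
  The label set of a tensor product is the Cartesian product of the label sets.
\<close>

instantiation "fun" :: (type, real_vector) real_vector
begin

definition scaleR_fun :: "real \<Rightarrow> ('a \<Rightarrow> 'b) \<Rightarrow> 'a \<Rightarrow> 'b"
  where "scaleR_fun r f = (\<lambda>x. r *\<^sub>R f x)"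

instance
  by standard (auto simp: scaleR_fun_def fun_eq_iff scaleR_add_right scaleR_add_left)

end

interpretation complex_fun: vector_space "\<lambda>(c::complex) (f::'i \<Rightarrow> complex) i. c * f i"
  by standard (auto simp: fun_eq_iff algebra_simps)

definition cspace :: "'i set \<Rightarrow> ('i \<Rightarrow> complex) set"
  where "cspace I = {v. \<forall>i. i \<notin> I \<longrightarrow> v i = 0}"

definition inner_on :: "'i set \<Rightarrow> ('i \<Rightarrow> complex) \<Rightarrow> ('i \<Rightarrow> complex) \<Rightarrow> complex"
  where "inner_on I u v = (\<Sum>i\<in>I. cnj (u i) * v i)"

definition norm_on :: "'i set \<Rightarrow> ('i \<Rightarrow> complex) \<Rightarrow> real"
  where "norm_on I v = sqrt (Re (inner_on I v v))"

type_synonym 'i oper = "'i \<Rightarrow> 'i \<Rightarrow> complex"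

definition opers :: "'i set \<Rightarrow> 'i oper set"
  where "opers I = {X. \<forall>i j. (i, j) \<notin> I \<times> I \<longrightarrow> X i j = 0}"

definition op_apply :: "'i set \<Rightarrow> 'i oper \<Rightarrow> ('i \<Rightarrow> complex) \<Rightarrow> ('i \<Rightarrow> complex)"
  where "op_apply I X v = (\<lambda>i. \<Sum>j\<in>I. X i j * v j)"

definition op_mult :: "'i set \<Rightarrow> 'i oper \<Rightarrow> 'i oper \<Rightarrow> 'i oper"
  where "op_mult I X Y = (\<lambda>i j. \<Sum>k\<in>I. X i k * Y k j)"

definition op_adj :: "'i oper \<Rightarrow> 'i oper"
  where "op_adj X = (\<lambda>i j. cnj (X j i))"

definition op_trace :: "'i set \<Rightarrow> 'i oper \<Rightarrow> complex"
  where "op_trace I X = (\<Sum>i\<in>I. X i i)"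

definition hs_norm :: "'i set \<Rightarrow> 'i oper \<Rightarrow> real"
  where "hs_norm I X = sqrt (Re (op_trace I (op_mult I (op_adj X) X)))"

definition psd :: "'i set \<Rightarrow> 'i oper \<Rightarrow> bool"
  where "psd I X \<longleftrightarrow> op_adj X = X \<and> (\<forall>v\<in>cspace I. 0 \<le> Re (inner_on I v (op_apply I X v)))"

text \<open>
  The density operators on a subspace \<open>V\<close> of \<open>\<complex>\<^sup>I\<close>. An operator on \<open>V\<close> is identified with its
  extension by zero on the orthogonal complement of \<open>V\<close>; for Hermitian operators
  on \<open>\<complex>\<^sup>I\<close> these extensions are exactly the ones with range in \<open>V\<close>.
\<close>
definition density_ops :: "'i set \<Rightarrow> ('i \<Rightarrow> complex) set \<Rightarrow> 'i oper set"
  where "density_ops I V =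
    {X \<in> opers I. psd I X \<and> op_trace I X = 1 \<and> (\<forall>v\<in>cspace I. op_apply I X v \<in> V)}"

definition ketbra :: "('i \<Rightarrow> complex) \<Rightarrow> 'i oper"
  where "ketbra u = (\<lambda>i j. u i * cnj (u j))"

definition tensor_vec :: "('i \<Rightarrow> complex) \<Rightarrow> ('j \<Rightarrow> complex) \<Rightarrow> ('i \<times> 'j \<Rightarrow> complex)"
  where "tensor_vec u v = (\<lambda>(i, j). u i * v j)"

definition tensor_op :: "'i oper \<Rightarrow> 'j oper \<Rightarrow> ('i \<times> 'j) oper"
  where "tensor_op X Y = (\<lambda>(i, k) (j, l). X i j * Y k l)"

definition tensor_space ::
    "('i \<Rightarrow> complex) set \<Rightarrow> ('j \<Rightarrow> complex) set \<Rightarrow> ('i \<times> 'j \<Rightarrow> complex) set"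
  where "tensor_space V W = complex_fun.span {tensor_vec v w | v w. v \<in> V \<and> w \<in> W}"

text \<open>
  The space \<open>\<complex>\<^sup>d\<close> has labels \<open>{..<d}\<close>, and its \<open>n\<close>-th tensor power has the lists of length \<open>n\<close>
  over \<open>{..<d}\<close> as labels; the head of the list belongs to the first tensor factor.
\<close>
definition words :: "nat \<Rightarrow> nat \<Rightarrow> nat list set"
  where "words d n = {xs. set xs \<subseteq> {..<d} \<and> length xs = n}"

definition Sym :: "nat \<Rightarrow> nat \<Rightarrow> (nat list \<Rightarrow> complex) set"
  where "Sym d n = {v \<in> cspace (words d n).
    \<forall>\<pi>. \<pi> permutes {..<n} \<longrightarrow> (\<forall>xs\<in>words d n. v (permute_list \<pi> xs) = v xs)}"

definition SEP :: "nat \<Rightarrow> (nat \<times> nat) oper set"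
  where "SEP d = convex hull {tensor_op (ketbra u) (ketbra v) | u v.
    u \<in> cspace {..<d} \<and> v \<in> cspace {..<d} \<and> norm_on {..<d} u = 1 \<and> norm_on {..<d} v = 1}"

text \<open>
  The \<open>A\<^sub>1B\<^sub>1\<close>-marginal: the labels of \<open>A\<^sub>2, \<dots>, A\<^sub>n\<close> and \<open>B\<^sub>2, \<dots>, B\<^sub>n\<close> are summed over.
\<close>
definition marginal :: "nat \<Rightarrow> nat \<Rightarrow> (nat list \<times> nat list) oper \<Rightarrow> (nat \<times> nat) oper"
  where "marginal d n X = (\<lambda>(a, b) (a', b').
    \<Sum>xs\<in>words d (n - 1). \<Sum>ys\<in>words d (n - 1). X (a # xs, b # ys) (a' # xs, b' # ys))"

text \<open>Meaningful for \<open>n \<ge> 1\<close> only.\<close>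
definition BEXT :: "nat \<Rightarrow> nat \<Rightarrow> (nat \<times> nat) oper set"
  where "BEXT n d = marginal d n `
    density_ops (words d n \<times> words d n) (tensor_space (Sym d n) (Sym d n))"

end

(* The partial transpose preserves the Hilbert-Schmidt norm and maps separable states to positive
   operators, so a state rho has distance at least t from SEP when the negative part of its partial
   transpose has norm t.  Take a condensate in level 0 and excite N or N + 1 (a superposition of
   both) of about 5n further levels, with the same set of excited levels on the A- and the B-side and
   N about n/2.  The coherence between |00> and |kk> then turns, under partial transposition, into a
   negative eigenvalue of order -1/n on the span of |0k> and |k0>.  There are of order n values of k,
   so these eigenvalues together have Hilbert-Schmidt norm of order sqrt(n) / n.  The witness below is
   the sum over k of the expectation values of the partial transpose in the vectors |0k> - |k0>. *)

theory Submission
  imports Defs "HOL-Combinatorics.Multiset_Permutations"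
begin

lemma finite_words: "finite (words d n)"
  unfolding words_def by (rule finite_lists_length_eq) simp

subsection \<open>The entanglement witness\<close>

text \<open>Transposing the second factor moves the entry \<open>X (0, 0) (k, k)\<close> to row
  |0k>, column |k0>. Each summand is thus the quadratic form of the partial transpose at |0k> -
  |k0>; \<open>Re\<close> makes it real for arbitrary \<open>X\<close>.\<close>

definition witness :: "nat \<Rightarrow> (nat \<times> nat) oper \<Rightarrow> real"
  where "witness d X = (\<Sum>k\<in>{1..<d}.
    Re (X (0, k) (0, k) + X (k, 0) (k, 0) - X (0, 0) (k, k) - X (k, k) (0, 0)))"

lemma witness_diff: "witness d (X - Y) = witness d X - witness d Y"
  by (simp add: witness_def algebra_simps sum.distrib sum_subtractf)

text \<open>The partial transpose of a product state is again a product state, with \<open>v\<close>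
  conjugated, so each summand is the squared modulus of an overlap with |0k> - |k0>.\<close>

lemma witness_product_nonneg: "0 \<le> witness d (tensor_op (ketbra u) (ketbra v))"
  unfolding witness_def
proof (rule sum_nonneg)
  fix k
  have "Re (tensor_op (ketbra u) (ketbra v) (0, k) (0, k) + tensor_op (ketbra u) (ketbra v) (k, 0) (k, 0)
      - tensor_op (ketbra u) (ketbra v) (0, 0) (k, k) - tensor_op (ketbra u) (ketbra v) (k, k) (0, 0))
    = (cmod (u 0 * cnj (v k) - u k * cnj (v 0)))\<^sup>2"
    unfolding cmod_power2 by (simp add: tensor_op_def ketbra_def) algebra
  then show "0 \<le> Re (tensor_op (ketbra u) (ketbra v) (0, k) (0, k) + tensor_op (ketbra u) (ketbra v) (k, 0) (k, 0)
      - tensor_op (ketbra u) (ketbra v) (0, 0) (k, k) - tensor_op (ketbra u) (ketbra v) (k, k) (0, 0))"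
    by simp
qed

lemma witness_SEP_nonneg:
  assumes "\<sigma> \<in> SEP d"
  shows "0 \<le> witness d \<sigma>"
proof -
  have lin: "witness d (a *\<^sub>R X + b *\<^sub>R Y) = a * witness d X + b * witness d Y" for a b X Y
    by (simp add: witness_def scaleR_fun_def sum_distrib_left flip: sum.distrib)
      (simp add: algebra_simps)
  have "convex {X. 0 \<le> witness d X}"
    by (auto simp: convex_def lin)
  then have "SEP d \<subseteq> {X. 0 \<le> witness d X}"
    unfolding SEP_def by (intro hull_minimal) (auto simp: witness_product_nonneg)
  with assms show ?thesis by auto
qed

lemma hs_norm_eq: "hs_norm I X = sqrt (\<Sum>i\<in>I. \<Sum>j\<in>I. (cmod (X i j))\<^sup>2)"
proof -
  have "Re (op_trace I (op_mult I (op_adj X) X)) = (\<Sum>j\<in>I. \<Sum>i\<in>I. (cmod (X i j))\<^sup>2)"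
    unfolding cmod_power2
    by (simp add: op_trace_def op_mult_def op_adj_def power2_eq_square)
  also have "\<dots> = (\<Sum>i\<in>I. \<Sum>j\<in>I. (cmod (X i j))\<^sup>2)"
    by (rule sum.swap)
  finally show ?thesis
    by (simp only: hs_norm_def)
qed

text \<open>Cauchy-Schwarz against the vector (1, 1, -1, -1), shown by writing the gap as a sum of
  squares over the six pairs.\<close>

lemma four_terms_power2: "(a + b - c - e)\<^sup>2 \<le> 4 * (a\<^sup>2 + b\<^sup>2 + c\<^sup>2 + (e::real)\<^sup>2)"
proof -
  have "4 * (a\<^sup>2 + b\<^sup>2 + c\<^sup>2 + e\<^sup>2) - (a + b - c - e)\<^sup>2
      = (a - b)\<^sup>2 + (a + c)\<^sup>2 + (a + e)\<^sup>2 + (b + c)\<^sup>2 + (b + e)\<^sup>2 + (c - e)\<^sup>2"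
    by (simp add: power2_eq_square algebra_simps)
  moreover have "0 \<le> \<dots>" by simp
  ultimately show ?thesis by linarith
qed

text \<open>Cauchy-Schwarz over \<open>k\<close>, then over the four entries of each summand.
  Different \<open>k\<close> use different matrix positions, so the squares add up to at most the
  squared Hilbert-Schmidt norm.\<close>

lemma witness_power2_le:
  fixes d :: nat
  shows "(witness d X)\<^sup>2 \<le> 4 * real d * (hs_norm ({..<d} \<times> {..<d}) X)\<^sup>2"
proof (cases "d = 0")
  case True
  then show ?thesis by (simp add: witness_def)
next
  case False
  let ?I = "{..<d} \<times> {..<d}"
  let ?K = "{1..<d}"
  define f where "f p = (cmod (X (fst p) (snd p)))\<^sup>2" for p
  have f_nonneg: "0 \<le> f p" for p by (simp add: f_def)
  have Re_le: "(Re (X p q))\<^sup>2 \<le> f (p, q)" for p q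
    by (simp add: f_def cmod_power2)
  \<comment> \<open>The positions of the four entries in the \<open>k\<close>-th summand; since
    \<open>k\<close> is at least 1, the four families of positions are disjoint.\<close>
  define e1 :: "nat \<Rightarrow> (nat \<times> nat) \<times> nat \<times> nat" where "e1 k = ((0, k), (0, k))" for k
  define e2 :: "nat \<Rightarrow> (nat \<times> nat) \<times> nat \<times> nat" where "e2 k = ((k, 0), (k, 0))" for k
  define e3 :: "nat \<Rightarrow> (nat \<times> nat) \<times> nat \<times> nat" where "e3 k = ((0, 0), (k, k))" for k
  define e4 :: "nat \<Rightarrow> (nat \<times> nat) \<times> nat \<times> nat" where "e4 k = ((k, k), (0, 0))" for k
  note e = e1_def e2_def e3_def e4_def
  have "(witness d X)\<^sup>2 \<le> (\<Sum>k\<in>?K. 1\<^sup>2) * (\<Sum>k\<in>?K. (Re (X (0, k) (0, k) + X (k, 0) (k, 0) - X (0, 0) (k, k) - X (k, k) (0, 0)))\<^sup>2)"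
    using Cauchy_Schwarz_ineq_sum[of "\<lambda>_. 1" _ ?K] unfolding witness_def by simp
  also have "\<dots> \<le> real d * (\<Sum>k\<in>?K. 4 * (f (e1 k) + f (e2 k) + f (e3 k) + f (e4 k)))"
  proof (intro mult_mono sum_mono)
    fix k
    show "(Re (X (0, k) (0, k) + X (k, 0) (k, 0) - X (0, 0) (k, k) - X (k, k) (0, 0)))\<^sup>2
        \<le> 4 * (f (e1 k) + f (e2 k) + f (e3 k) + f (e4 k))"
      using four_terms_power2[of "Re (X (0, k) (0, k))" "Re (X (k, 0) (k, 0))"
          "Re (X (0, 0) (k, k))" "Re (X (k, k) (0, 0))"]
        Re_le[of "(0, k)" "(0, k)"] Re_le[of "(k, 0)" "(k, 0)"]
        Re_le[of "(0, 0)" "(k, k)"] Re_le[of "(k, k)" "(0, 0)"]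
      by (simp add: e)
  qed (auto simp: sum_nonneg)
  also have "\<dots> = 4 * real d * (sum f (e1 ` ?K) + sum f (e2 ` ?K) + sum f (e3 ` ?K) + sum f (e4 ` ?K))"
    by (subst (1 2 3 4) sum.reindex)
      (auto simp: e inj_on_def sum.distrib sum_distrib_left algebra_simps)
  also have "sum f (e1 ` ?K) + sum f (e2 ` ?K) + sum f (e3 ` ?K) + sum f (e4 ` ?K)
      = sum f (e1 ` ?K \<union> e2 ` ?K \<union> e3 ` ?K \<union> e4 ` ?K)"
  proof -
    have "e1 ` ?K \<inter> e2 ` ?K = {}" "(e1 ` ?K \<union> e2 ` ?K) \<inter> e3 ` ?K = {}"
      "(e1 ` ?K \<union> e2 ` ?K \<union> e3 ` ?K) \<inter> e4 ` ?K = {}"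
      by (auto simp: e)
    then show ?thesis by (simp add: sum.union_disjoint)
  qed
  also have "4 * real d * \<dots> \<le> 4 * real d * sum f (?I \<times> ?I)"
    using False by (intro mult_left_mono sum_mono2) (auto simp: e f_nonneg)
  also have "sum f (?I \<times> ?I) = (hs_norm ?I X)\<^sup>2"
    by (simp add: hs_norm_eq f_def sum.cartesian_product case_prod_beta sum_nonneg)
  finally show ?thesis .
qed

subsection \<open>Dicke states\<close>

text \<open>For \<open>S\<close> not containing \<open>0\<close>: the unnormalised symmetric state of \<open>n\<close> particles,
  one in each level of \<open>S\<close> and all others in level \<open>0\<close>.\<close>
definition dicke :: "nat \<Rightarrow> nat set \<Rightarrow> nat list \<Rightarrow> complex"
  where "dicke n S xs = of_bool (mset xs = mset_set S + replicate_mset (n - card S) 0)"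

lemma cnj_dicke [simp]: "cnj (dicke n S xs) = dicke n S xs"
  by (simp add: dicke_def)

text \<open>\<open>card S \<le> n\<close> makes the multiset have exactly \<open>n\<close> elements,
  and \<open>0 < d\<close> makes the filler 0 an admissible letter.\<close>

lemma mset_dicke_words:
  assumes "S \<subseteq> {1..<d}" "card S \<le> n" "0 < d"
    and "mset xs = mset_set S + replicate_mset (n - card S) 0"
  shows "xs \<in> words d n"
proof -
  have "finite S" using assms(1) finite_subset by blast
  moreover have "set xs = set_mset (mset_set S + replicate_mset (n - card S) 0)"
    by (metis assms(4) set_mset_mset)
  moreover have "length xs = size (mset_set S + replicate_mset (n - card S) (0::nat))"
    by (metis assms(4) size_mset)
  ultimately show ?thesis
    using assms(1-3) by (auto simp: words_def split: if_splits)
qed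

lemma dicke_Sym:
  assumes "S \<subseteq> {1..<d}" "card S \<le> n" "0 < d"
  shows "dicke n S \<in> Sym d n"
  using mset_dicke_words[OF assms]
  by (auto simp: Sym_def cspace_def dicke_def words_def mset_permute_list)

text \<open>The strict inequality leaves a particle in level 0 that can be split off.\<close>

lemma dicke_Cons_0:
  assumes "card S < n"
  shows "dicke n S (0 # xs) = dicke (n - 1) S xs"
proof -
  have "replicate_mset (n - card S) (0::nat) = add_mset 0 (replicate_mset (n - 1 - card S) 0)"
    using assms by (metis Suc_diff_Suc diff_Suc_eq_diff_pred replicate_mset_Suc)
  then show ?thesis by (simp add: dicke_def)
qed

lemma dicke_Cons:
  assumes "k \<noteq> 0" "finite S"
  shows "dicke n S (k # xs) = of_bool (k \<in> S) * dicke (n - 1) (S - {k}) xs"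
proof (cases "k \<in> S")
  case True
  then have "mset_set S = add_mset k (mset_set (S - {k}))"
    using assms by (simp add: mset_set.remove)
  moreover have "card S = Suc (card (S - {k}))"
    using True assms(2) by (rule card.remove[rotated])
  then have "n - card S = n - 1 - card (S - {k})" by linarith
  ultimately show ?thesis using True by (simp add: dicke_def)
next
  case False
  have "k \<notin># mset_set S + replicate_mset (n - card S) 0"
    using False assms by auto
  moreover have "k \<in># mset (k # xs)" by simp
  ultimately have "mset (k # xs) \<noteq> mset_set S + replicate_mset (n - card S) 0" by metis
  then show ?thesis using False by (simp add: dicke_def)
qed

text \<open>The sum counts the arrangements of a multiset in which 0 has multiplicity
  \<open>n - card S\<close> and every other level multiplicity 1. As the entries are 0 or 1, it is
  also the squared norm.\<close>

lemma sum_dicke: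
  assumes S: "S \<subseteq> {1..<d}" and "card S \<le> n" "0 < d"
  shows "(\<Sum>xs\<in>words d n. dicke n S xs) = fact n / fact (n - card S)"
proof -
  let ?M = "mset_set S + replicate_mset (n - card S) (0::nat)"
  have fin: "finite S" using S finite_subset by blast
  have [simp]: "0 \<notin> S" using S by auto
  have "(\<Sum>xs\<in>words d n. dicke n S xs) = of_nat (card {xs \<in> words d n. mset xs = ?M})"
    by (simp add: dicke_def of_bool_def sum.If_cases finite_words Int_def)
  also have "{xs \<in> words d n. mset xs = ?M} = permutations_of_multiset ?M"
    using mset_dicke_words[OF assms] by (auto simp: permutations_of_multiset_def)
  finally have card: "(\<Sum>xs\<in>words d n. dicke n S xs) = of_nat (card (permutations_of_multiset ?M))" .
  \<comment> \<open>If \<open>card S = n\<close>, then 0 does not occur in the multiset; including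
    it only adds the factor \<open>fact 0\<close>.\<close>
  have "(\<Prod>x\<in>set_mset ?M. fact (count ?M x)) = (\<Prod>x\<in>insert 0 S. fact (count ?M x) :: nat)"
    by (rule prod.mono_neutral_left) (use fin in \<open>auto simp: not_in_iff\<close>)
  also have "\<dots> = fact (n - card S)"
  proof -
    have "fact (count ?M x) = (1::nat)" if "x \<in> S" for x
      using that fin by (cases "x = 0") auto
    then show ?thesis using fin by simp
  qed
  finally have "fact (n - card S) * card (permutations_of_multiset ?M) = fact (size ?M)"
    by (metis card_permutations_of_multiset_aux mult.commute)
  also have "size ?M = n" using assms(2) by simp
  finally have "fact (n - card S) * card (permutations_of_multiset ?M) = fact n" .
  then have "fact (n - card S) * of_nat (card (permutations_of_multiset ?M)) = (fact n :: complex)"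
    by (metis of_nat_fact of_nat_mult)
  then show ?thesis
    unfolding card by (simp add: field_simps)
qed

text \<open>\<open>S\<close> can be read off from a word as its set of nonzero letters, so different
  sets give vectors with disjoint supports.\<close>

lemma dicke_orthogonal:
  assumes S: "S \<subseteq> {1..<d}" and T: "T \<subseteq> {1..<d}" and "card S \<le> n" "0 < d"
  shows "(\<Sum>xs\<in>words d n. dicke n S xs * dicke n T xs) = of_bool (S = T) * (fact n / fact (n - card S))"
proof -
  have "S = T" if "mset_set S + replicate_mset (n - card S) 0 = mset_set T + replicate_mset (n - card T) 0"
  proof -
    have "finite S" "finite T" using S T finite_subset by blast+
    moreover have "set_mset (mset_set S + replicate_mset (n - card S) 0) - {0}
        = set_mset (mset_set T + replicate_mset (n - card T) 0) - {0}"
      using that by simp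
    moreover have "0 \<notin> S" "0 \<notin> T" using S T by auto
    ultimately show ?thesis by (auto split: if_splits)
  qed
  then have "dicke n S xs * dicke n T xs = of_bool (S = T) * dicke n S xs" for xs
    by (auto simp: dicke_def)
  then have "(\<Sum>xs\<in>words d n. dicke n S xs * dicke n T xs) = of_bool (S = T) * (\<Sum>xs\<in>words d n. dicke n S xs)"
    by (simp only: sum_distrib_left)
  then show ?thesis
    by (simp only: sum_dicke[OF S assms(3,4)])
qed

subsection \<open>Superpositions of products of Dicke states\<close>

text \<open>The range of the projection consists of multiples of \<open>\<Psi>\<close>, which is all
  that \<open>V\<close> has to contain.\<close>

lemma ketbra_density_ops:
  assumes "finite I" and \<Psi>: "\<Psi> \<in> cspace I" and norm: "inner_on I \<Psi> \<Psi> = 1"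
    and V: "\<And>c. (\<lambda>i. c * \<Psi> i) \<in> V"
  shows "ketbra \<Psi> \<in> density_ops I V"
proof -
  have app: "op_apply I (ketbra \<Psi>) v = (\<lambda>i. inner_on I \<Psi> v * \<Psi> i)" for v
    by (auto simp: op_apply_def ketbra_def inner_on_def sum_distrib_right sum_distrib_left mult_ac
        intro!: ext sum.cong)
  \<comment> \<open>The quadratic form is z times its conjugate, hence nonnegative.\<close>
  have "inner_on I v (\<lambda>i. inner_on I \<Psi> v * \<Psi> i) = inner_on I \<Psi> v * cnj (inner_on I \<Psi> v)" for v
    by (simp add: inner_on_def sum_distrib_left sum_distrib_right cnj_sum mult_ac) (rule sum.swap)
  then have "psd I (ketbra \<Psi>)"
    unfolding psd_def app by (auto simp: op_adj_def ketbra_def complex_mult_cnj mult.commute)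
  moreover have "op_trace I (ketbra \<Psi>) = 1"
    using norm by (simp add: op_trace_def ketbra_def inner_on_def mult_ac)
  moreover have "ketbra \<Psi> \<in> opers I"
    using \<Psi> by (auto simp: opers_def ketbra_def cspace_def)
  ultimately show ?thesis
    by (simp add: density_ops_def app V)
qed

lemma sum_fun_apply: "(\<Sum>i\<in>A. f i) x = (\<Sum>i\<in>A. f i x)"
  by (induction A rule: infinite_finite_induct) auto

text \<open>Both sides carry the same set \<open>S\<close>, so a level is excited on A and B
  together; this is the source of the coherence between |00> and |kk>.\<close>

definition dicke_pairs :: "nat \<Rightarrow> nat set set \<Rightarrow> (nat set \<Rightarrow> real) \<Rightarrow> nat list \<times> nat list \<Rightarrow> complex"
  where "dicke_pairs n F c = (\<lambda>(xs, ys). \<Sum>S\<in>F. of_real (c S) * (dicke n S xs * dicke n S ys))"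

lemma dicke_pairs_tensor_space:
  assumes "0 < d" and F: "\<And>S. S \<in> F \<Longrightarrow> S \<subseteq> {1..<d} \<and> card S \<le> n"
  shows "dicke_pairs n F c \<in> tensor_space (Sym d n) (Sym d n)"
proof -
  have "dicke_pairs n F c = (\<Sum>S\<in>F. (\<lambda>p. of_real (c S) * tensor_vec (dicke n S) (dicke n S) p))"
    by (auto simp: dicke_pairs_def tensor_vec_def sum_fun_apply)
  also have "\<dots> \<in> tensor_space (Sym d n) (Sym d n)"
    unfolding tensor_space_def
  proof (intro complex_fun.span_sum complex_fun.span_scale complex_fun.span_base)
    fix S assume "S \<in> F"
    then have "dicke n S \<in> Sym d n" using F dicke_Sym \<open>0 < d\<close> by simp
    then show "tensor_vec (dicke n S) (dicke n S) \<in> {tensor_vec v w | v w. v \<in> Sym d n \<and> w \<in> Sym d n}"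
      by blast
  qed
  finally show ?thesis .
qed

lemma dicke_pairs_cspace:
  assumes "0 < d" and F: "\<And>S. S \<in> F \<Longrightarrow> S \<subseteq> {1..<d} \<and> card S \<le> n"
  shows "dicke_pairs n F c \<in> cspace (words d n \<times> words d n)"
proof -
  have "dicke n S xs = 0" if "S \<in> F" "xs \<notin> words d n" for S xs
    using dicke_Sym[OF _ _ \<open>0 < d\<close>] F that by (auto simp: Sym_def cspace_def)
  then show ?thesis
    by (auto simp: cspace_def dicke_pairs_def intro!: sum.neutral)
qed

section \<open>Norm and marginal as sums over pairs of sets\<close>

lemma sum_pairs: "(\<Sum>x\<in>A. \<Sum>y\<in>B. h x y) = (\<Sum>p\<in>A \<times> B. h (fst p) (snd p))"
  by (simp add: sum.cartesian_product case_prod_beta)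

text \<open>Overlaps of product vectors factorise into an A-part and a B-part. Four separate
  families are allowed because the marginal fixes different first letters in rows and columns and on
  the two sides.\<close>

lemma sum_product_expand:
  fixes f f' g g' :: "'s \<Rightarrow> 'x \<Rightarrow> complex"
  shows "(\<Sum>x\<in>A. \<Sum>y\<in>A. (\<Sum>S\<in>F. c S * (f S x * g S y)) * (\<Sum>T\<in>F. c T * (f' T x * g' T y)))
    = (\<Sum>S\<in>F. \<Sum>T\<in>F. c S * c T * ((\<Sum>x\<in>A. f S x * f' T x) * (\<Sum>y\<in>A. g S y * g' T y)))"
proof -
  have product_pairs: "(\<Sum>x\<in>A. u x) * (\<Sum>y\<in>A. v y) = (\<Sum>p\<in>A \<times> A. u (fst p) * v (snd p))"
    for u v :: "'x \<Rightarrow> complex"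
    by (simp add: sum_product sum_pairs)
  define h where "h S T x y = c S * c T * ((f S x * f' T x) * (g S y * g' T y))" for S T x y
  have "(\<Sum>S\<in>F. c S * (f S x * g S y)) * (\<Sum>T\<in>F. c T * (f' T x * g' T y))
      = (\<Sum>q\<in>F \<times> F. h (fst q) (snd q) x y)" for x y
    unfolding sum_product sum_pairs by (simp add: h_def mult_ac)
  then have "(\<Sum>x\<in>A. \<Sum>y\<in>A. (\<Sum>S\<in>F. c S * (f S x * g S y)) * (\<Sum>T\<in>F. c T * (f' T x * g' T y)))
      = (\<Sum>p\<in>A \<times> A. \<Sum>q\<in>F \<times> F. h (fst q) (snd q) (fst p) (snd p))"
    by (simp only: sum_pairs[of _ A A])
  also have "\<dots> = (\<Sum>q\<in>F \<times> F. \<Sum>p\<in>A \<times> A. h (fst q) (snd q) (fst p) (snd p))"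
    by (rule sum.swap)
  also have "\<dots> = (\<Sum>q\<in>F \<times> F. c (fst q) * c (snd q)
      * ((\<Sum>x\<in>A. f (fst q) x * f' (snd q) x) * (\<Sum>y\<in>A. g (fst q) y * g' (snd q) y)))"
    by (simp only: h_def product_pairs sum_distrib_left[where r = "c _ * c _"])
  finally show ?thesis
    by (simp only: sum_pairs)
qed

text \<open>For \<open>k \<le> n\<close> this is the falling factorial n(n-1)...(n-k+1), the squared
  norm of a Dicke vector with \<open>k\<close> excitations.\<close>

abbreviation falling :: "nat \<Rightarrow> nat \<Rightarrow> real"
  where "falling n k \<equiv> fact n / fact (n - k)"

lemma inner_dicke_pairs:
  assumes "0 < d" "finite F" and F: "\<And>S. S \<in> F \<Longrightarrow> S \<subseteq> {1..<d} \<and> card S \<le> n"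
  shows "inner_on (words d n \<times> words d n) (dicke_pairs n F c) (dicke_pairs n F c)
    = of_real (\<Sum>S\<in>F. (c S * falling n (card S))\<^sup>2)"
proof -
  have "inner_on (words d n \<times> words d n) (dicke_pairs n F c) (dicke_pairs n F c)
    = (\<Sum>x\<in>words d n. \<Sum>y\<in>words d n.
        (\<Sum>S\<in>F. of_real (c S) * (dicke n S x * dicke n S y))
        * (\<Sum>T\<in>F. of_real (c T) * (dicke n T x * dicke n T y)))"
    by (simp add: inner_on_def dicke_pairs_def sum.cartesian_product case_prod_beta cnj_sum)
  also have "\<dots> = (\<Sum>S\<in>F. \<Sum>T\<in>F. of_real (c S) * of_real (c T) *
      (of_bool (S = T) * (fact n / fact (n - card S)) * (of_bool (S = T) * (fact n / fact (n - card S)))))"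
    unfolding sum_product_expand
    using F dicke_orthogonal[OF _ _ _ \<open>0 < d\<close>] by (intro sum.cong refl) simp
  also have "\<dots> = (\<Sum>S\<in>F. \<Sum>T\<in>F. if S = T then of_real ((c S * falling n (card S))\<^sup>2) else 0)"
    by (intro sum.cong refl) (simp add: power2_eq_square mult_ac)
  finally show ?thesis
    using \<open>finite F\<close> by simp
qed

lemma marginal_dicke_pairs:
  "marginal d n (ketbra (dicke_pairs n F c)) (a, b) (a', b') =
    (\<Sum>S\<in>F. \<Sum>T\<in>F. of_real (c S) * of_real (c T) *
      ((\<Sum>xs\<in>words d (n - 1). dicke n S (a # xs) * dicke n T (a' # xs))
       * (\<Sum>ys\<in>words d (n - 1). dicke n S (b # ys) * dicke n T (b' # ys))))"
  unfolding sum_product_expand[symmetric]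
  by (simp add: marginal_def ketbra_def dicke_pairs_def cnj_sum)

section \<open>Overlaps after fixing one particle, entries of the marginal, and the witness
  value\<close>

context
  fixes d n :: nat and F :: "nat set set" and c :: "nat set \<Rightarrow> real"
  assumes d: "0 < d" and fin: "finite F"
    and F: "\<And>S. S \<in> F \<Longrightarrow> S \<subseteq> {1..<d} \<and> card S < n"
begin

lemma overlap_00:
  assumes "S \<in> F" "T \<in> F"
  shows "(\<Sum>xs\<in>words d (n - 1). dicke n S (0 # xs) * dicke n T (0 # xs))
    = of_bool (S = T) * falling (n - 1) (card S)"
proof -
  have "card S \<le> n - 1" using F[OF assms(1)] by linarith
  then show ?thesis
    using F[OF assms(1)] F[OF assms(2)] dicke_orthogonal[OF _ _ _ d, of S T "n - 1"]
    by (simp add: dicke_Cons_0)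
qed

text \<open>Splitting off a 0 on the left and a \<open>k\<close> on the right leaves the sets
  \<open>S\<close> and \<open>T - {k}\<close>, which must agree by orthogonality.\<close>

lemma overlap_0k:
  assumes "S \<in> F" "T \<in> F" "k \<noteq> 0"
  shows "(\<Sum>xs\<in>words d (n - 1). dicke n S (0 # xs) * dicke n T (k # xs))
    = of_bool (k \<notin> S \<and> T = insert k S) * falling (n - 1) (card S)"
proof -
  have "card S \<le> n - 1" "T - {k} \<subseteq> {1..<d}" using F[OF assms(1)] F[OF assms(2)] by auto
  moreover have "finite T" using F[OF assms(2)] finite_subset by blast
  moreover have "k \<in> T \<and> S = T - {k} \<longleftrightarrow> k \<notin> S \<and> T = insert k S" by blast
  moreover have "(\<Sum>xs\<in>words d (n - 1). dicke n S (0 # xs) * dicke n T (k # xs))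
    = of_bool (k \<in> T) * (\<Sum>xs\<in>words d (n - 1). dicke (n - 1) S xs * dicke (n - 1) (T - {k}) xs)"
    using F[OF assms(1)] \<open>finite T\<close> assms(3) by (simp add: dicke_Cons_0 dicke_Cons)
  ultimately show ?thesis
    using F[OF assms(1)] dicke_orthogonal[OF _ _ _ d, of S "T - {k}" "n - 1"]
    by auto
qed

lemma overlap_kk:
  assumes "S \<in> F" "T \<in> F" "k \<noteq> 0"
  shows "(\<Sum>xs\<in>words d (n - 1). dicke n S (k # xs) * dicke n T (k # xs))
    = of_bool (k \<in> S \<and> k \<in> T \<and> S = T) * falling (n - 1) (card S - 1)"
proof -
  have fin: "finite S" "finite T"
    by (meson F assms finite_subset finite_atLeastLessThan)+
  have sub: "S - {k} \<subseteq> {1..<d}" "T - {k} \<subseteq> {1..<d}" using F[OF assms(1)] F[OF assms(2)] by auto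
  have card: "card (S - {k}) \<le> n - 1"
    using F[OF assms(1)] card_Diff1_le[of S k] by linarith
  have "(\<Sum>xs\<in>words d (n - 1). dicke n S (k # xs) * dicke n T (k # xs))
    = of_bool (k \<in> S) * of_bool (k \<in> T) *
      (\<Sum>xs\<in>words d (n - 1). dicke (n - 1) (S - {k}) xs * dicke (n - 1) (T - {k}) xs)"
    using fin assms(3) by (simp add: dicke_Cons)
  also have "\<dots> = of_bool (k \<in> S) * of_bool (k \<in> T) *
      (of_bool (S - {k} = T - {k}) * (fact (n - 1) / fact (n - 1 - card (S - {k}))))"
    by (simp only: dicke_orthogonal[OF sub card d])
  also have "\<dots> = of_bool (k \<in> S \<and> k \<in> T \<and> S = T) * falling (n - 1) (card S - 1)"
  proof (cases "k \<in> S \<and> k \<in> T")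
    case True
    then have eq: "(S - {k} = T - {k}) = (S = T)" by blast
    show ?thesis
      unfolding eq using True fin by (simp add: card_Diff_singleton)
  qed auto
  finally show ?thesis .
qed

text \<open>One side contributes \<open>overlap_00\<close> and the other \<open>overlap_kk\<close>;
  both vanish unless \<open>S = T\<close>.\<close>

lemma marginal_0k_0k:
  assumes "k \<noteq> 0"
  defines "w \<equiv> \<lambda>S. of_bool (k \<in> S) * ((c S)\<^sup>2 * (falling (n - 1) (card S) * falling (n - 1) (card S - 1)))"
  shows "marginal d n (ketbra (dicke_pairs n F c)) (0, k) (0, k) = of_real (\<Sum>S\<in>F. w S)"
    and "marginal d n (ketbra (dicke_pairs n F c)) (k, 0) (k, 0) = of_real (\<Sum>S\<in>F. w S)"
proof -
  have "marginal d n (ketbra (dicke_pairs n F c)) (0, k) (0, k)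
      = (\<Sum>S\<in>F. \<Sum>T\<in>F. if S = T then of_real (w S) else 0)"
    unfolding marginal_dicke_pairs w_def
    by (intro sum.cong refl)
      (simp add: overlap_00 overlap_kk assms(1) power2_eq_square mult_ac del: One_nat_def)
  then show "marginal d n (ketbra (dicke_pairs n F c)) (0, k) (0, k) = of_real (\<Sum>S\<in>F. w S)"
    using fin by simp
  have "marginal d n (ketbra (dicke_pairs n F c)) (k, 0) (k, 0)
      = (\<Sum>S\<in>F. \<Sum>T\<in>F. if S = T then of_real (w S) else 0)"
    unfolding marginal_dicke_pairs w_def
    by (intro sum.cong refl)
      (simp add: overlap_00 overlap_kk assms(1) power2_eq_square mult_ac del: One_nat_def)
  then show "marginal d n (ketbra (dicke_pairs n F c)) (k, 0) (k, 0) = of_real (\<Sum>S\<in>F. w S)"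
    using fin by simp
qed

text \<open>Both sides force \<open>T = insert k S\<close>, so this entry only sees coherence
  between sets whose sizes differ by one. This is why two consecutive excitation numbers are
  superposed.\<close>

lemma marginal_00_kk:
  assumes "k \<noteq> 0"
  defines "w \<equiv> \<lambda>S. of_bool (k \<notin> S \<and> insert k S \<in> F) * (c S * c (insert k S) * (falling (n - 1) (card S))\<^sup>2)"
  shows "marginal d n (ketbra (dicke_pairs n F c)) (0, 0) (k, k) = of_real (\<Sum>S\<in>F. w S)"
    and "marginal d n (ketbra (dicke_pairs n F c)) (k, k) (0, 0) = of_real (\<Sum>S\<in>F. w S)"
proof -
  have "marginal d n (ketbra (dicke_pairs n F c)) (0, 0) (k, k)
      = (\<Sum>S\<in>F. \<Sum>T\<in>F. if T = insert k S then of_real (w S) else 0)"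
    unfolding marginal_dicke_pairs w_def
    by (intro sum.cong refl)
      (simp add: overlap_0k assms(1) power2_eq_square mult_ac del: One_nat_def, blast)
  also have "\<dots> = (\<Sum>S\<in>F. of_real (w S))"
    using fin by (intro sum.cong refl) (auto simp: w_def)
  finally show eq: "marginal d n (ketbra (dicke_pairs n F c)) (0, 0) (k, k) = of_real (\<Sum>S\<in>F. w S)"
    by simp
  \<comment> \<open>The marginal is Hermitian, and the entry just computed is real.\<close>
  have "marginal d n (ketbra (dicke_pairs n F c)) (k, k) (0, 0)
      = cnj (marginal d n (ketbra (dicke_pairs n F c)) (0, 0) (k, k))"
    by (simp add: marginal_def ketbra_def cnj_sum mult_ac)
  then show "marginal d n (ketbra (dicke_pairs n F c)) (k, k) (0, 0) = of_real (\<Sum>S\<in>F. w S)"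
    by (simp add: eq)
qed

text \<open>After exchanging the sums over \<open>k\<close> and \<open>S\<close>, each
  \<open>S\<close> is counted once for each of its elements in the diagonal part.\<close>

lemma witness_dicke_pairs:
  "witness d (marginal d n (ketbra (dicke_pairs n F c))) =
    2 * ((\<Sum>S\<in>F. real (card S) * ((c S)\<^sup>2 * (falling (n - 1) (card S) * falling (n - 1) (card S - 1))))
      - (\<Sum>S\<in>F. \<Sum>k\<in>{1..<d}. of_bool (k \<notin> S \<and> insert k S \<in> F) *
          (c S * c (insert k S) * (falling (n - 1) (card S))\<^sup>2)))"
proof -
  define a where "a S = (c S)\<^sup>2 * (falling (n - 1) (card S) * falling (n - 1) (card S - 1))" for S
  define b where "b k S = of_bool (k \<notin> S \<and> insert k S \<in> F) *
    (c S * c (insert k S) * (falling (n - 1) (card S))\<^sup>2)" for k S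
  have "witness d (marginal d n (ketbra (dicke_pairs n F c)))
      = (\<Sum>k\<in>{1..<d}. 2 * ((\<Sum>S\<in>F. of_bool (k \<in> S) * a S) - (\<Sum>S\<in>F. b k S)))"
    unfolding witness_def
  proof (intro sum.cong refl)
    fix k assume "k \<in> {1..<d}"
    then have k: "k \<noteq> 0" by simp
    show "Re (marginal d n (ketbra (dicke_pairs n F c)) (0, k) (0, k)
        + marginal d n (ketbra (dicke_pairs n F c)) (k, 0) (k, 0)
        - marginal d n (ketbra (dicke_pairs n F c)) (0, 0) (k, k)
        - marginal d n (ketbra (dicke_pairs n F c)) (k, k) (0, 0))
      = 2 * ((\<Sum>S\<in>F. of_bool (k \<in> S) * a S) - (\<Sum>S\<in>F. b k S))"
      unfolding marginal_0k_0k[OF k] marginal_00_kk[OF k] a_def[symmetric] b_def[symmetric]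
      by (simp del: of_real_sum)
  qed
  also have "\<dots> = 2 * ((\<Sum>k\<in>{1..<d}. \<Sum>S\<in>F. of_bool (k \<in> S) * a S) - (\<Sum>k\<in>{1..<d}. \<Sum>S\<in>F. b k S))"
    by (simp only: sum_subtractf flip: sum_distrib_left)
  also have "(\<Sum>k\<in>{1..<d}. \<Sum>S\<in>F. of_bool (k \<in> S) * a S) = (\<Sum>S\<in>F. \<Sum>k\<in>{1..<d}. of_bool (k \<in> S) * a S)"
    by (rule sum.swap)
  also have "\<dots> = (\<Sum>S\<in>F. real (card S) * a S)"
  proof (intro sum.cong refl)
    fix S assume "S \<in> F"
    then have "{1..<d} \<inter> S = S" using F by blast
    then show "(\<Sum>k\<in>{1..<d}. of_bool (k \<in> S) * a S) = real (card S) * a S"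
      by (simp flip: sum_distrib_right)
  qed
  also have "(\<Sum>k\<in>{1..<d}. \<Sum>S\<in>F. b k S) = (\<Sum>S\<in>F. \<Sum>k\<in>{1..<d}. b k S)"
    by (rule sum.swap)
  finally show ?thesis by (simp only: a_def b_def)
qed

end

section \<open>Membership in \<open>BEXT\<close> and the choice of amplitudes\<close>

lemma dicke_pairs_BEXT:
  assumes "0 < d" "finite F" and F: "\<And>S. S \<in> F \<Longrightarrow> S \<subseteq> {1..<d} \<and> card S \<le> n"
    and norm: "(\<Sum>S\<in>F. (c S * falling n (card S))\<^sup>2) = 1"
  shows "marginal d n (ketbra (dicke_pairs n F c)) \<in> BEXT n d"
  unfolding BEXT_def
proof (intro imageI ketbra_density_ops)
  show "inner_on (words d n \<times> words d n) (dicke_pairs n F c) (dicke_pairs n F c) = 1"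
    using inner_dicke_pairs[OF assms(1,2) F, of c] norm by (simp only: of_real_1)
  show "(\<lambda>i. a * dicke_pairs n F c i) \<in> tensor_space (Sym d n) (Sym d n)" for a
    using dicke_pairs_tensor_space[OF assms(1) F]
    unfolding tensor_space_def by (rule complex_fun.span_scale)
qed (simp_all add: finite_words dicke_pairs_cspace[OF assms(1) F])

text \<open>With \<open>10 N + 9\<close> excitable levels there are exactly \<open>9\<close> times as many sets of size \<open>N + 1\<close> as of
  size \<open>N\<close>, so the amplitudes \<open>c\<close> that give both sizes the same weight have a rational ratio.\<close>
lemma BEXT_witness_le:
  assumes "4 \<le> n"
  defines "d \<equiv> 10 * (n div 2) + 10"
  shows "\<exists>\<rho>\<in>BEXT n d. witness d \<rho> \<le> - 1 / 4"
proof -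
  define N where "N = n div 2"
  define m where "m = n - N"
  define F0 where "F0 = {S. S \<subseteq> {1..<d} \<and> card S = N}"
  define F1 where "F1 = {S. S \<subseteq> {1..<d} \<and> card S = Suc N}"
  define C where "C = real ((10 * N + 9) choose N)"
  define Q where "Q = falling (n - 1) N"
  \<comment> \<open>The product of two Dicke vectors has norm \<open>n * Q / m\<close> for size
    \<open>N\<close> and \<open>n * Q\<close> for size \<open>N + 1\<close>. With \<open>C\<close>
    and \<open>9 * C\<close> sets, amplitudes in the ratio \<open>3 * m\<close> to 1 give both sizes
    equal weight, and \<open>K\<close> makes the total weight 1.\<close>
  define K where "K = sqrt (18 * C) * real n * Q"
  define c where "c S = (if card S = N then 3 * real m / K else 1 / K)" for S :: "nat set"
  let ?F = "F0 \<union> F1"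
  have N: "1 \<le> N" "Suc N < n" "2 \<le> m" "2 * N \<le> n" "n \<le> 2 * N + 1" and n: "real n = real N + real m"
    using assms(1) by (auto simp: N_def m_def)
  have d: "0 < d" "d - 1 = 10 * N + 9" by (auto simp: d_def N_def)
  have fin: "finite F0" "finite F1" by (auto simp: F0_def F1_def)
  have disj: "F0 \<inter> F1 = {}" by (auto simp: F0_def F1_def)
  have F: "S \<subseteq> {1..<d} \<and> card S < n" if "S \<in> ?F" for S
    using that N by (auto simp: F0_def F1_def)
  have card0: "real (card F0) = C"
    by (simp add: F0_def n_subsets d(2) C_def del: One_nat_def)
  have card1: "real (card F1) = 9 * C"
  proof -
    have "Suc N * ((10 * N + 9) choose Suc N) = (10 * N + 9 - N) * ((10 * N + 9) choose N)"
      by (simp only: binomial_absorption binomial_absorb_comp)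
    also have "10 * N + 9 - N = Suc N * 9" by simp
    finally have "Suc N * ((10 * N + 9) choose Suc N) = Suc N * (9 * ((10 * N + 9) choose N))"
      by (simp only: mult.assoc)
    then have "(10 * N + 9) choose Suc N = 9 * ((10 * N + 9) choose N)"
      by (simp only: nat_mult_eq_cancel1 zero_less_Suc)
    then show ?thesis
      by (simp add: F1_def n_subsets d(2) C_def del: One_nat_def binomial_Suc_Suc)
  qed
  have "0 < C" by (simp add: C_def)
  moreover have "0 < Q" by (simp add: Q_def)
  ultimately have K: "0 < K" "K\<^sup>2 = 18 * C * (real n)\<^sup>2 * Q\<^sup>2"
    using N by (auto simp: K_def power_mult_distrib)

  have fact_n: "fact n = real n * fact (n - 1)"
    using N by (simp add: fact_reduce)
  have fact_m: "fact m = real m * fact (m - 1)" "fact (m - 1) = (real m - 1) * fact (m - 2)"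
  proof -
    have "real (m - 1) = real m - 1" "m - 1 - 1 = m - 2" using N by auto
    then show "fact m = real m * fact (m - 1)" "fact (m - 1) = (real m - 1) * fact (m - 2)"
      using N fact_reduce[of m, where 'a = real] fact_reduce[of "m - 1", where 'a = real] by auto
  qed
  \<comment> \<open>No subtraction is truncated here, because \<open>N\<close> is at least 1 and
    \<open>m\<close> at least 2.\<close>
  have diffs: "n - N = m" "n - 1 - N = m - 1" "n - Suc N = m - 1" "n - 1 - Suc N = m - 2" "n - 1 - (N - 1) = m"
    using N by (auto simp: m_def)
  have q: "falling n N = real n * Q / real m" "falling n (Suc N) = real n * Q"
    "falling (n - 1) (N - 1) = Q / real m" "falling (n - 1) (Suc N) = Q * (real m - 1)"
    unfolding Q_def diffs fact_n fact_m using N by (simp_all add: field_simps)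

  \<comment> \<open>All summands depend only on the size of the set, so a sum over the family
    reduces to two values with multiplicities \<open>C\<close> and \<open>9 * C\<close>.\<close>
  have sumF: "(\<Sum>S\<in>?F. f S) = C * a + 9 * C * b"
    if "\<And>S. S \<in> F0 \<Longrightarrow> f S = a" "\<And>S. S \<in> F1 \<Longrightarrow> f S = b" for f :: "nat set \<Rightarrow> real" and a b
    using that by (simp add: sum.union_disjoint[OF fin disj] card0 card1)
  have "(\<Sum>S\<in>?F. (c S * falling n (card S))\<^sup>2)
      = C * (3 * real m / K * (real n * Q / real m))\<^sup>2 + 9 * C * (1 / K * (real n * Q))\<^sup>2"
    by (rule sumF) (auto simp: F0_def F1_def c_def q simp del: One_nat_def)
  also have "\<dots> = 1"
    using N K \<open>0 < C\<close> \<open>0 < Q\<close> by (simp add: power_divide power_mult_distrib)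
  finally have norm: "(\<Sum>S\<in>?F. (c S * falling n (card S))\<^sup>2) = 1" .
  have diag: "(\<Sum>S\<in>?F. real (card S) * ((c S)\<^sup>2 * (falling (n - 1) (card S) * falling (n - 1) (card S - 1))))
      = C * (real N * ((3 * real m / K)\<^sup>2 * (Q * (Q / real m))))
        + 9 * C * (real (Suc N) * ((1 / K)\<^sup>2 * (Q * (real m - 1) * Q)))"
  proof (rule sumF)
    fix S assume "S \<in> F0"
    then have card: "card S = N" by (simp add: F0_def)
    show "real (card S) * ((c S)\<^sup>2 * (falling (n - 1) (card S) * falling (n - 1) (card S - 1)))
      = real N * ((3 * real m / K)\<^sup>2 * (Q * (Q / real m)))"
      unfolding c_def card q Q_def[symmetric] by simp
  next
    fix S assume "S \<in> F1"
    then have card: "card S = Suc N" by (simp add: F1_def)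
    show "real (card S) * ((c S)\<^sup>2 * (falling (n - 1) (card S) * falling (n - 1) (card S - 1)))
      = real (Suc N) * ((1 / K)\<^sup>2 * (Q * (real m - 1) * Q))"
      unfolding c_def card diff_Suc_1 q Q_def[symmetric] by simp
  qed
  \<comment> \<open>A set of size \<open>N\<close> can be enlarged by any of the
    \<open>9 * (N + 1)\<close> remaining levels, whereas enlarging one of size \<open>N + 1\<close>
    leaves the family.\<close>
  have offdiag: "(\<Sum>S\<in>?F. \<Sum>k\<in>{1..<d}. of_bool (k \<notin> S \<and> insert k S \<in> ?F) *
        (c S * c (insert k S) * (falling (n - 1) (card S))\<^sup>2))
      = C * (9 * real (Suc N) * (3 * real m / K * (1 / K) * Q\<^sup>2)) + 9 * C * 0"
  proof (rule sumF)
    fix S assume S: "S \<in> F0"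
    then have sub: "S \<subseteq> {1..<d}" and card: "card S = N" by (auto simp: F0_def)
    have finS: "finite S" using sub finite_subset by blast
    have "(\<Sum>k\<in>{1..<d}. of_bool (k \<notin> S \<and> insert k S \<in> ?F) *
        (c S * c (insert k S) * (falling (n - 1) (card S))\<^sup>2))
      = (\<Sum>k\<in>{1..<d}. if k \<in> {1..<d} - S then 3 * real m / K * (1 / K) * Q\<^sup>2 else 0)"
    proof (rule sum.cong[OF refl])
      fix k assume "k \<in> {1..<d}"
      show "of_bool (k \<notin> S \<and> insert k S \<in> ?F) *
          (c S * c (insert k S) * (falling (n - 1) (card S))\<^sup>2)
        = (if k \<in> {1..<d} - S then 3 * real m / K * (1 / K) * Q\<^sup>2 else 0)"
      proof (cases "k \<in> S")
        case False
        then have "card (insert k S) = Suc N" "insert k S \<in> F1"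
          using sub card finS \<open>k \<in> {1..<d}\<close> by (auto simp: F1_def)
        then show ?thesis
          using False \<open>k \<in> {1..<d}\<close> card by (simp add: c_def Q_def del: One_nat_def)
      qed simp
    qed
    also have "\<dots> = real (card ({1..<d} - S)) * (3 * real m / K * (1 / K) * Q\<^sup>2)"
      by (subst sum.inter_restrict[symmetric]) (auto simp: Int_absorb1)
    also have "card ({1..<d} - S) = 9 * Suc N"
      using sub finS card d by (subst card_Diff_subset) auto
    finally show "(\<Sum>k\<in>{1..<d}. of_bool (k \<notin> S \<and> insert k S \<in> ?F) *
        (c S * c (insert k S) * (falling (n - 1) (card S))\<^sup>2))
      = 9 * real (Suc N) * (3 * real m / K * (1 / K) * Q\<^sup>2)"
      by simp
  next
    fix S assume "S \<in> F1"
    then have "S \<subseteq> {1..<d}" and "card S = Suc N" by (auto simp: F1_def)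
    then have "finite S" by (meson finite_subset finite_atLeastLessThan)
    have "insert k S \<notin> ?F" if "k \<notin> S" for k
    proof -
      have "card (insert k S) = Suc (Suc N)"
        using \<open>finite S\<close> \<open>card S = Suc N\<close> that by simp
      then show ?thesis by (simp add: F0_def F1_def)
    qed
    then show "(\<Sum>k\<in>{1..<d}. of_bool (k \<notin> S \<and> insert k S \<in> ?F) *
        (c S * c (insert k S) * (falling (n - 1) (card S))\<^sup>2)) = 0"
      by (intro sum.neutral) auto
  qed
  have "witness d (marginal d n (ketbra (dicke_pairs n ?F c)))
      = 2 * (C * (real N * ((3 * real m / K)\<^sup>2 * (Q * (Q / real m))))
        + 9 * C * (real (Suc N) * ((1 / K)\<^sup>2 * (Q * (real m - 1) * Q)))
        - (C * (9 * real (Suc N) * (3 * real m / K * (1 / K) * Q\<^sup>2)) + 9 * C * 0))"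
    using witness_dicke_pairs[OF d(1) _ F, of ?F c] fin unfolding diag offdiag by simp
  also have "\<dots> = 18 * C * Q\<^sup>2 / K\<^sup>2 * (real N * real m + real (Suc N) * (real m - 1) - 3 * real (Suc N) * real m)"
    using \<open>0 < K\<close> \<open>2 \<le> m\<close> by (simp add: field_simps power2_eq_square)
  also have "\<dots> = (real N * real m + real (Suc N) * (real m - 1) - 3 * real (Suc N) * real m) / (real n)\<^sup>2"
    using \<open>0 < C\<close> \<open>0 < Q\<close> N unfolding K by (simp add: field_simps)
  \<comment> \<open>The numerator equals -(m(N + 2) + N + 1), and n is at most both 2m and 2(N +
    2).\<close>
  also have "\<dots> \<le> - 1 / 4"
  proof -
    have "real n * real n \<le> (2 * real m) * (2 * (real N + 2))"
      using N n by (intro mult_mono) auto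
    then show ?thesis
      using N by (simp add: field_simps power2_eq_square)
  qed
  finally show ?thesis
    using dicke_pairs_BEXT[OF d(1) _ _ norm] fin F by (meson finite_UnI less_imp_le)
qed

section \<open>From the witness value to the Hilbert-Schmidt distance\<close>

theorem theoremB7:
  shows "\<exists>c::real. c > 0 \<and> (\<exists>n0::nat. n0 \<ge> 1 \<and> (\<forall>n\<ge>n0.
    (SUP d\<in>{2..}. SUP \<rho>\<in>BEXT n d. INF \<sigma>\<in>SEP d. ereal (hs_norm ({..<d} \<times> {..<d}) (\<rho> - \<sigma>)))
      \<ge> ereal (c * real n powr (- 1 / 2))))"
proof (intro exI[of _ "1 / 24"] exI[of _ 4] conjI allI impI)
  fix n :: nat assume n: "4 \<le> n"
  define d where "d = 10 * (n div 2) + 10"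
  obtain \<rho> where \<rho>: "\<rho> \<in> BEXT n d" "witness d \<rho> \<le> - 1 / 4"
    using BEXT_witness_le[OF n] unfolding d_def by blast
  have "1 / 24 * real n powr (- 1 / 2) \<le> hs_norm ({..<d} \<times> {..<d}) (\<rho> - \<sigma>)" if "\<sigma> \<in> SEP d" for \<sigma>
  proof -
    let ?h = "hs_norm ({..<d} \<times> {..<d}) (\<rho> - \<sigma>)"
    have "0 \<le> ?h"
      unfolding hs_norm_eq by (intro real_sqrt_ge_zero sum_nonneg zero_le_power2)
    \<comment> \<open>Linearity, with a nonnegative value on \<open>\<sigma>\<close>, keeps the gap
      of 1/4 for every separable state.\<close>
    have "1 / 4 \<le> - witness d (\<rho> - \<sigma>)"
      using witness_SEP_nonneg[OF that] \<rho>(2) by (simp add: witness_diff)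
    then have "(1 / 4)\<^sup>2 \<le> (- witness d (\<rho> - \<sigma>))\<^sup>2"
      by (rule power_mono) simp
    also have "\<dots> = (witness d (\<rho> - \<sigma>))\<^sup>2" by (rule power2_minus)
    also have "\<dots> \<le> 4 * real d * ?h\<^sup>2" by (rule witness_power2_le)
    also have "\<dots> \<le> 36 * real n * ?h\<^sup>2"
    proof (rule mult_right_mono)
      have "4 * d = 40 * (n div 2) + 40" by (simp add: d_def)
      moreover have "2 * (n div 2) \<le> n" by simp
      ultimately have "4 * d \<le> 36 * n" using n by linarith
      then show "4 * real d \<le> 36 * real n" by linarith
    qed simp
    \<comment> \<open>Division by 36 turns 1/4 into 1/24 after taking square roots.\<close>
    finally have "(1 / 24)\<^sup>2 \<le> (sqrt (real n) * ?h)\<^sup>2"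
      by (simp add: power_mult_distrib power_one_over)
    then have "1 / 24 \<le> sqrt (real n) * ?h"
      using \<open>0 \<le> ?h\<close> by (intro power2_le_imp_le[of "1 / 24"]) auto
    moreover have powr: "real n powr (- 1 / 2) = 1 / sqrt (real n)"
      using powr_minus_divide[of "real n" "1 / 2"] by (simp add: powr_half_sqrt)
    moreover have "0 < sqrt (real n)" using n by simp
    ultimately show ?thesis
      unfolding powr by (simp add: field_simps)
  qed
  \<comment> \<open>The bound is uniform in \<open>\<sigma>\<close>, so it passes to the infimum;
    the particular \<open>\<rho>\<close> and \<open>d\<close> then bound both suprema from
    below.\<close>
  then have "ereal (1 / 24 * real n powr (- 1 / 2))
      \<le> (INF \<sigma>\<in>SEP d. ereal (hs_norm ({..<d} \<times> {..<d}) (\<rho> - \<sigma>)))"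
    by (intro INF_greatest) simp
  also have "\<dots> \<le> (SUP \<rho>\<in>BEXT n d. INF \<sigma>\<in>SEP d. ereal (hs_norm ({..<d} \<times> {..<d}) (\<rho> - \<sigma>)))"
    by (rule SUP_upper[OF \<rho>(1)])
  also have "\<dots> \<le> (SUP d\<in>{2..}. SUP \<rho>\<in>BEXT n d. INF \<sigma>\<in>SEP d. ereal (hs_norm ({..<d} \<times> {..<d}) (\<rho> - \<sigma>)))"
    by (rule SUP_upper[where f = "\<lambda>d. SUP \<rho>\<in>BEXT n d. INF \<sigma>\<in>SEP d. ereal (hs_norm ({..<d} \<times> {..<d}) (\<rho> - \<sigma>))"])
      (simp add: d_def)
  finally show "ereal (1 / 24 * real n powr (- 1 / 2))
      \<le> (SUP d\<in>{2..}. SUP \<rho>\<in>BEXT n d. INF \<sigma>\<in>SEP d. ereal (hs_norm ({..<d} \<times> {..<d}) (\<rho> - \<sigma>)))" .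
qed auto

end
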